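(* Let $n=d+m(d-2)$ with $d\ge 3$ and $m\in\mathbb{N}_0$. Let $\mathcal{T}$ be a $d$-angulation of the convex $n$-gon $\mathcal{P}_n$ and let $M_\mathcal{T}=(m_{i,j})$ be its associated matrix of numbers of $d$-paths. Then $m_{i,j}=m_{j,i}$ for all $1\le i,j\le n$, i.e. $M_\mathcal{T}$ is symmetric.
   Context: $\mathcal{P}_n$ is a convex $n$-gon whose vertices are labelled $1,\dots,n$ in counterclockwise order; vertex labels are taken modulo $n$. A $d$-angulation of $\mathcal{P}_n$ is a dissection of $\mathcal{P}_n$ by pairwise non-crossing diagonals into $d$-gons. For vertices $i,j$, a (counterclockwise) $d$-path from $i$ to $j$ is a sequence $p_{i+1},p_{i+2},\dots,p_{j-1}$ of $d$-gons of $\mathcal{T}$, indexed by the vertices met strictly between $i$ and $j$ when going counterclockwise from $i$ to $j$ (the empty sequence if $j=i+1$; the $n-1$ vertices other than $i$ if $j=i$), such that (i) $p_k$ is incident to vertex $k$ for every such $k$, and (ii) every $d$-gon of $\mathcal{T}$ appears at most $d-2$ times in the sequence. $m_{i,j}$ is the number of $d$-paths from $i$ to $j$ and $M_\mathcal{T}=(m_{i,j})_{1\le i,j\le n}$. *)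

theory Defs
  imports Main "HOL-Library.FuncSet"
begin

text \<open>
  The convex polygon with \<open>n\<close> vertices is encoded by its vertex labels \<open>{1..n}\<close>, read
  counterclockwise.  Every set of at least three labels spans a convex subpolygon, and edges
  and diagonals are two-element sets of labels; incidence, crossing and the pieces of a
  dissection depend only on the cyclic order of the labels.
\<close>

text \<open>
  The vertices met strictly between \<open>i\<close> and \<open>j\<close> when going counterclockwise from \<open>i\<close> to \<open>j\<close>.
  For \<open>i = j\<close> this is a full turn, i.e. all vertices other than \<open>i\<close>.
\<close>
definition ccw_between :: "nat \<Rightarrow> nat \<Rightarrow> nat \<Rightarrow> nat set" where
  "ccw_between n i j = {k \<in> {1..n}. if i < j then i < k \<and> k < j else i < k \<or> k < j}"

text \<open>Sides and diagonals of the subpolygon spanned by \<open>S \<subseteq> {1..n}\<close>.\<close>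

definition polygon_sides :: "nat \<Rightarrow> nat set \<Rightarrow> nat set set" where
  "polygon_sides n S = {{a, b} | a b. a \<in> S \<and> b \<in> S \<and> a \<noteq> b \<and> S \<inter> ccw_between n a b = {}}"

definition polygon_diagonals :: "nat \<Rightarrow> nat set \<Rightarrow> nat set set" where
  "polygon_diagonals n S = {{a, b} | a b. a \<in> S \<and> b \<in> S \<and> a \<noteq> b} - polygon_sides n S"

definition crossing :: "nat \<Rightarrow> nat set \<Rightarrow> nat set \<Rightarrow> bool" where
  "crossing n e f \<longleftrightarrow> (\<exists>a b a' b'. e = {a, b} \<and> f = {a', b'} \<and>
     a' \<in> ccw_between n a b \<and> b' \<in> ccw_between n b a)"

definition dissection :: "nat \<Rightarrow> nat set set \<Rightarrow> bool" where
  "dissection n D \<longleftrightarrow> D \<subseteq> polygon_diagonals n {1..n} \<and> (\<forall>e\<in>D. \<forall>f\<in>D. \<not> crossing n e f)"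

text \<open>
  The polygons, given by their vertex sets, into which a dissection \<open>D\<close> cuts the \<open>n\<close>-gon: the
  subpolygons bounded by sides of the \<open>n\<close>-gon and members of \<open>D\<close> that are not cut further by
  \<open>D\<close>.  A member of \<open>D\<close> meeting the interior of such a subpolygon crosses none of its sides,
  hence is one of its diagonals, so it suffices to exclude the latter.
\<close>
definition pieces :: "nat \<Rightarrow> nat set set \<Rightarrow> nat set set" where
  "pieces n D = {S. S \<subseteq> {1..n} \<and> 3 \<le> card S \<and>
     polygon_sides n S \<subseteq> polygon_sides n {1..n} \<union> D \<and> polygon_diagonals n S \<inter> D = {}}"

definition d_angulation :: "nat \<Rightarrow> nat \<Rightarrow> nat set set \<Rightarrow> bool" where
  "d_angulation d n T \<longleftrightarrow> dissection n T \<and> (\<forall>S\<in>pieces n T. card S = d)"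

text \<open>
  A path is a family of pieces indexed by the vertices strictly between \<open>i\<close> and \<open>j\<close>;
  extensional functions make distinct functions distinct families, so that they can be counted.
\<close>
definition d_paths :: "nat \<Rightarrow> nat \<Rightarrow> nat set set \<Rightarrow> nat \<Rightarrow> nat \<Rightarrow> (nat \<Rightarrow> nat set) set" where
  "d_paths d n T i j = {p \<in> ccw_between n i j \<rightarrow>\<^sub>E pieces n T.
     (\<forall>k\<in>ccw_between n i j. k \<in> p k) \<and>
     (\<forall>S\<in>pieces n T. card {k \<in> ccw_between n i j. p k = S} \<le> d - 2)}"

definition path_matrix :: "nat \<Rightarrow> nat \<Rightarrow> nat set set \<Rightarrow> nat \<Rightarrow> nat \<Rightarrow> nat" where
  "path_matrix d n T i j = card (d_paths d n T i j)"

end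

theory Submission
  imports Defs
begin

text \<open>
  Give a piece \<open>S\<close> of an arbitrary dissection of a polygon \<open>P\<close> the capacity \<open>card S - 2\<close>; the
  capacities then add up to \<open>card P - 2\<close>.  Cut \<open>P\<close> along a diagonal \<open>{a, b}\<close> into \<open>P1\<close> and \<open>P2\<close>
  and induct on the number of vertices.  If \<open>i, j\<close> both lie in \<open>P1\<close>, one of the two ways around
  contains every vertex of \<open>P2\<close> off the diagonal; these saturate the pieces of \<open>P2\<close> in exactly one
  way, and both counts reduce to those in \<open>P1\<close>.  If \<open>i\<close> lies strictly on the side of \<open>P1\<close> and \<open>j\<close>
  on that of \<open>P2\<close>, choosing on which side the vertex \<open>b\<close> between \<open>i\<close> and \<open>j\<close> gets its piece gives
  the Ptolemy-like formula \<open>m i j = m1 i b * m2 a j + m1 i a * m2 b j\<close>, and likewise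
  \<open>m j i = m2 j a * m1 b i + m2 j b * m1 a i\<close>; by induction the two agree.
\<close>

section \<open>Counting capacity-constrained assignments\<close>

text \<open>The bound depends on the piece and the index set is arbitrary: cutting a polygon splits
  a path into index sets that need not be arcs, and the counting works for pieces of mixed
  sizes.\<close>

definition assignments :: "nat set \<Rightarrow> nat set set \<Rightarrow> (nat \<Rightarrow> nat set) set" where
  "assignments X Q = {p \<in> X \<rightarrow>\<^sub>E Q.
     (\<forall>k\<in>X. k \<in> p k) \<and> (\<forall>S\<in>Q. card {k \<in> X. p k = S} \<le> card S - 2)}"

lemma finite_assignments:
  "finite X \<Longrightarrow> finite Q \<Longrightarrow> finite (assignments X Q)"
  unfolding assignments_def by (simp add: finite_PiE)

lemma card_assignments_empty: "card (assignments {} Q) = 1"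
proof -
  have "assignments {} Q = {\<lambda>_. undefined}"
    unfolding assignments_def by auto
  then show ?thesis by simp
qed

lemma assignments_eq_empty_if_uncovered:
  assumes "\<not> X \<subseteq> \<Union>Q"
  shows "assignments X Q = {}"
  using assms unfolding assignments_def by (fastforce dest: PiE_mem)

text \<open>Pigeonhole: the fibres of an assignment partition \<open>X\<close>, and their sizes are
  bounded by the capacities.\<close>

lemma assignments_eq_empty_if_overfull:
  assumes "finite X" "finite Q" "(\<Sum>S\<in>Q. card S - 2) < card X"
  shows "assignments X Q = {}"
proof (rule ccontr)
  assume "assignments X Q \<noteq> {}"
  then obtain p where p: "p \<in> X \<rightarrow>\<^sub>E Q" "\<forall>S\<in>Q. card {k \<in> X. p k = S} \<le> card S - 2"
    unfolding assignments_def by blast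
  have "X = (\<Union>S\<in>Q. {k \<in> X. p k = S})"
    using p(1) by (auto dest: PiE_mem)
  then have "card X = card (\<Union>S\<in>Q. {k \<in> X. p k = S})" by simp
  also have "\<dots> = (\<Sum>S\<in>Q. card {k \<in> X. p k = S})"
    by (rule card_UN_disjoint) (use assms in auto)
  also have "\<dots> \<le> (\<Sum>S\<in>Q. card S - 2)"
    by (rule sum_mono) (use p in auto)
  finally show False using assms by simp
qed

lemma card_assignments_singleton:
  assumes "X \<subseteq> S" "card X \<le> card S - 2"
  shows "card (assignments X {S}) = 1"
proof -
  have "p = restrict (\<lambda>_. S) X" if "p \<in> X \<rightarrow>\<^sub>E {S}" for p
    using that by (intro ext) (auto simp: PiE_iff extensional_def)
  moreover have "{k \<in> X. restrict (\<lambda>_. S) X k = S} = X" by auto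
  ultimately have "assignments X {S} = {restrict (\<lambda>_. S) X}"
    using assms unfolding assignments_def by auto
  then show ?thesis by simp
qed

text \<open>An assignment determines the set \<open>Y\<close> of indices served by
  \<open>Q1\<close>, since \<open>Q1\<close> and \<open>Q2\<close> are disjoint. The capacity
  conditions concern one piece at a time, so the restrictions to \<open>Y\<close> and
  \<open>X - Y\<close> are independent.\<close>

lemma card_assignments_union:
  assumes X: "finite X" and Q: "finite Q1" "finite Q2" "Q1 \<inter> Q2 = {}"
  shows "card (assignments X (Q1 \<union> Q2)) =
    (\<Sum>Y\<in>Pow X. card (assignments Y Q1) * card (assignments (X - Y) Q2))"
proof -
  define I where "I = (SIGMA Y:Pow X. assignments Y Q1 \<times> assignments (X - Y) Q2)"
  define split where "split p = (let Y = {k \<in> X. p k \<in> Q1} in (Y, restrict p Y, restrict p (X - Y)))"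
    for p :: "nat \<Rightarrow> nat set"
  \<comment> \<open>Outside \<open>X\<close> the glued function agrees with \<open>r\<close>, which
    is \<open>undefined\<close> there, so gluing stays extensional.\<close>
  define glue :: "nat set \<times> (nat \<Rightarrow> nat set) \<times> (nat \<Rightarrow> nat set) \<Rightarrow> nat \<Rightarrow> nat set"
    where "glue = (\<lambda>(Y, q, r) k. if k \<in> Y then q k else r k)"
  have "bij_betw split (assignments X (Q1 \<union> Q2)) I"
  proof (rule bij_betw_byWitness[where f' = glue])
    show "\<forall>p\<in>assignments X (Q1 \<union> Q2). glue (split p) = p"
      unfolding assignments_def glue_def split_def
      by (auto simp: fun_eq_iff PiE_iff extensional_def restrict_def)
    show "\<forall>z\<in>I. split (glue z) = z"
    proof
      fix z assume "z \<in> I"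
      then obtain Y q r where z: "z = (Y, q, r)" "Y \<subseteq> X"
          "q \<in> assignments Y Q1" "r \<in> assignments (X - Y) Q2"
        unfolding I_def by auto
      have "q \<in> Y \<rightarrow>\<^sub>E Q1" "r \<in> (X - Y) \<rightarrow>\<^sub>E Q2"
        using z(3,4) unfolding assignments_def by auto
      then have "{k \<in> X. glue z k \<in> Q1} = Y" and "restrict (glue z) Y = q"
        and "restrict (glue z) (X - Y) = r"
        using z(1,2) Q(3) unfolding glue_def
        by (auto simp: PiE_iff fun_eq_iff restrict_def extensional_def)
      then show "split (glue z) = z"
        unfolding split_def z(1) by simp
    qed
    show "split ` assignments X (Q1 \<union> Q2) \<subseteq> I"
    proof (rule image_subsetI)
      fix p assume p: "p \<in> assignments X (Q1 \<union> Q2)"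
      define Y where "Y = {k \<in> X. p k \<in> Q1}"
      have fib1: "{k \<in> Y. restrict p Y k = S} = {k \<in> X. p k = S}" if "S \<in> Q1" for S
        using that unfolding Y_def by auto
      have fib2: "{k \<in> X - Y. restrict p (X - Y) k = S} = {k \<in> X. p k = S}" if "S \<in> Q2" for S
        using that Q(3) unfolding Y_def by auto
      have "restrict p Y \<in> assignments Y Q1"
        using p unfolding assignments_def by (auto simp: fib1 simp del: restrict_apply) (auto simp: Y_def PiE_iff)
      moreover have "restrict p (X - Y) \<in> assignments (X - Y) Q2"
      proof -
        have "restrict p (X - Y) \<in> (X - Y) \<rightarrow>\<^sub>E Q2" "\<forall>k\<in>X - Y. k \<in> restrict p (X - Y) k"
          using p unfolding assignments_def Y_def by auto
        moreover have "\<forall>S\<in>Q2. card {k \<in> X - Y. restrict p (X - Y) k = S} \<le> card S - 2"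
          using p fib2 unfolding assignments_def by force
        ultimately show ?thesis unfolding assignments_def by blast
      qed
      moreover have "split p = (Y, restrict p Y, restrict p (X - Y))"
        unfolding split_def Y_def by (simp add: Let_def)
      ultimately show "split p \<in> I"
        unfolding I_def Y_def by auto
    qed
    show "glue ` I \<subseteq> assignments X (Q1 \<union> Q2)"
    proof clarify
      fix Y q r assume "(Y, q, r) \<in> I"
      then have Y: "Y \<subseteq> X" and q: "q \<in> assignments Y Q1" and r: "r \<in> assignments (X - Y) Q2"
        unfolding I_def by auto
      have qr: "q \<in> Y \<rightarrow>\<^sub>E Q1" "r \<in> (X - Y) \<rightarrow>\<^sub>E Q2"
        using q r unfolding assignments_def by auto
      have "{k \<in> X. glue (Y, q, r) k = S} = {k \<in> Y. q k = S}" if "S \<in> Q1" for S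
        using that qr Y Q(3) unfolding glue_def by (fastforce simp: PiE_iff)
      moreover have "{k \<in> X. glue (Y, q, r) k = S} = {k \<in> X - Y. r k = S}" if "S \<in> Q2" for S
        using that qr Y Q(3) unfolding glue_def by (fastforce simp: PiE_iff)
      moreover have "glue (Y, q, r) \<in> X \<rightarrow>\<^sub>E (Q1 \<union> Q2)"
        using qr Y unfolding glue_def by (auto simp: PiE_iff extensional_def)
      moreover have "\<forall>k\<in>X. k \<in> glue (Y, q, r) k"
        using q r Y unfolding glue_def assignments_def by auto
      ultimately show "glue (Y, q, r) \<in> assignments X (Q1 \<union> Q2)"
        using q r unfolding assignments_def by auto
    qed
  qed
  then have "card (assignments X (Q1 \<union> Q2)) = card I"
    by (rule bij_betw_same_card)
  also have "\<dots> = (\<Sum>Y\<in>Pow X. card (assignments Y Q1 \<times> assignments (X - Y) Q2))"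
    unfolding I_def using X Q
    by (intro card_SigmaI) (auto intro!: finite_assignments intro: finite_subset)
  finally show ?thesis by (simp add: card_cartesian_product)
qed

text \<open>A summand vanishes when \<open>Y\<close> leaves \<open>P1\<close>, when
  \<open>X - Y\<close> leaves \<open>P2\<close>, or when \<open>X - Y\<close> exceeds the capacity
  of \<open>Q2\<close>. It thus suffices that \<open>F\<close> contains every \<open>Y\<close>
  passing these three tests.\<close>

lemma card_assignments_union_cover:
  assumes P: "\<Union>Q1 \<subseteq> P1" "\<Union>Q2 \<subseteq> P2" "finite P1" "finite P2"
    and Q: "Q1 \<inter> Q2 = {}" and X: "finite X" and F: "F \<subseteq> Pow X"
    and others: "\<And>Y. Y \<subseteq> X \<Longrightarrow> Y \<subseteq> P1 \<Longrightarrow> X - Y \<subseteq> P2 \<Longrightarrow>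
      card (X - Y) \<le> (\<Sum>S\<in>Q2. card S - 2) \<Longrightarrow> Y \<in> F"
  shows "card (assignments X (Q1 \<union> Q2)) =
    (\<Sum>Y\<in>F. card (assignments Y Q1) * card (assignments (X - Y) Q2))"
proof -
  have fin: "finite Q1" "finite Q2"
    using P finite_UnionD finite_subset by metis+
  have "card (assignments Y Q1) * card (assignments (X - Y) Q2) = 0" if Y: "Y \<in> Pow X - F" for Y
  proof -
    consider "\<not> Y \<subseteq> P1" | "\<not> X - Y \<subseteq> P2" | "(\<Sum>S\<in>Q2. card S - 2) < card (X - Y)"
      using others[of Y] Y by (metis DiffD1 DiffD2 PowD not_le)
    then show ?thesis
    proof cases
      case 1
      then have "assignments Y Q1 = {}"
        using assignments_eq_empty_if_uncovered P(1) by (metis order_trans)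
      then show ?thesis by simp
    next
      case 2
      then have "assignments (X - Y) Q2 = {}"
        using assignments_eq_empty_if_uncovered P(2) by (metis order_trans)
      then show ?thesis by simp
    next
      case 3
      then have "assignments (X - Y) Q2 = {}"
        using assignments_eq_empty_if_overfull X fin by simp
      then show ?thesis by simp
    qed
  qed
  then show ?thesis
    unfolding card_assignments_union[OF X fin Q]
    using X F by (intro sum.mono_neutral_right) auto
qed

lemma card_assignments_union_one_side:
  assumes P: "\<Union>Q1 \<subseteq> P1" "\<Union>Q2 \<subseteq> P2" "finite P1" "finite P2"
    and Q: "Q1 \<inter> Q2 = {}" and X: "X \<subseteq> P1 - P2"
  shows "card (assignments X (Q1 \<union> Q2)) = card (assignments X Q1)"
proof -
  have "finite X" using X P(3) by (meson Diff_subset finite_subset)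
  then have "card (assignments X (Q1 \<union> Q2)) =
      (\<Sum>Y\<in>{X}. card (assignments Y Q1) * card (assignments (X - Y) Q2))"
    by (rule card_assignments_union_cover[OF P Q]) (use X in auto)
  then show ?thesis by (simp add: card_assignments_empty)
qed

text \<open>The vertices of \<open>P2 - P1\<close> can only be served by \<open>Q2\<close> and use
  up its whole capacity. Shared vertices are therefore forced into \<open>Q1\<close>, and the part
  in \<open>Q2\<close> has a single choice.\<close>

lemma card_assignments_union_saturated:
  assumes P: "\<Union>Q1 \<subseteq> P1" "\<Union>Q2 \<subseteq> P2" "finite P1" "finite P2"
    and Q: "Q1 \<inter> Q2 = {}" and X: "X \<subseteq> P1 \<union> P2" "P2 - P1 \<subseteq> X"
    and full: "(\<Sum>S\<in>Q2. card S - 2) = card (P2 - P1)" "card (assignments (P2 - P1) Q2) = 1"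
  shows "card (assignments X (Q1 \<union> Q2)) = card (assignments (X \<inter> P1) Q1)"
proof -
  have fin: "finite X" using X(1) P(3,4) by (meson finite_UnI finite_subset)
  have "card (assignments X (Q1 \<union> Q2)) =
      (\<Sum>Y\<in>{X \<inter> P1}. card (assignments Y Q1) * card (assignments (X - Y) Q2))"
  proof (rule card_assignments_union_cover[OF P Q fin])
    fix Y assume Y: "Y \<subseteq> X" "Y \<subseteq> P1" "card (X - Y) \<le> (\<Sum>S\<in>Q2. card S - 2)"
    have "P2 - P1 \<subseteq> X - Y" using X(2) Y(2) by blast
    then have "P2 - P1 = X - Y"
      using Y(3) fin full(1) by (metis card_seteq finite_Diff)
    then show "Y \<in> {X \<inter> P1}" using Y(1,2) by blast
  qed simp
  moreover have "X - X \<inter> P1 = P2 - P1" using X by blast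
  ultimately show ?thesis using full(2) by simp
qed

text \<open>Only the shared vertex \<open>c\<close> can choose a side; the two products correspond
  to its choices.\<close>

lemma card_assignments_union_straddle:
  assumes P: "\<Union>Q1 \<subseteq> P1" "\<Union>Q2 \<subseteq> P2" "finite P1" "finite P2"
    and Q: "Q1 \<inter> Q2 = {}" and X: "X1 \<subseteq> P1 - P2" "X2 \<subseteq> P2 - P1" "c \<in> P1" "c \<in> P2"
  shows "card (assignments (insert c (X1 \<union> X2)) (Q1 \<union> Q2)) =
    card (assignments X1 Q1) * card (assignments (insert c X2) Q2) +
    card (assignments (insert c X1) Q1) * card (assignments X2 Q2)"
proof -
  let ?X = "insert c (X1 \<union> X2)"
  have fin: "finite ?X" using X P(3,4) by (meson Diff_subset finite_UnI finite_insert finite_subset)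
  have "card (assignments ?X (Q1 \<union> Q2)) =
      (\<Sum>Y\<in>{X1, insert c X1}. card (assignments Y Q1) * card (assignments (?X - Y) Q2))"
    by (rule card_assignments_union_cover[OF P Q fin]) (use X in blast)+
  moreover have "?X - X1 = insert c X2" "?X - insert c X1 = X2" "X1 \<noteq> insert c X1"
    using X by auto
  ultimately show ?thesis by simp
qed

section \<open>Cutting a dissected polygon along a diagonal\<close>

text \<open>The notion \<open>pieces\<close> relative to a subpolygon \<open>P\<close>. The set
  \<open>D\<close> is kept whole when \<open>P\<close> is cut, so the same \<open>D\<close> serves
  both parts.\<close>

definition subpieces :: "nat \<Rightarrow> nat set \<Rightarrow> nat set set \<Rightarrow> nat set set" where
  "subpieces n P D = {S. S \<subseteq> P \<and> 3 \<le> card S \<and>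
     polygon_sides n S \<subseteq> polygon_sides n P \<union> D \<and> polygon_diagonals n S \<inter> D = {}}"

definition arc :: "nat \<Rightarrow> nat set \<Rightarrow> nat \<Rightarrow> nat \<Rightarrow> nat set" where
  "arc n P a b = {x \<in> P. x = a \<or> x = b \<or> x \<in> ccw_between n a b}"

section \<open>Gaps between cyclically consecutive vertices\<close>

lemma mem_ccw_between:
  "k \<in> ccw_between n i j \<longleftrightarrow> 1 \<le> k \<and> k \<le> n \<and> (if i < j then i < k \<and> k < j else i < k \<or> k < j)"
  unfolding ccw_between_def by auto

lemma finite_subpieces: "finite P \<Longrightarrow> finite (subpieces n P D)"
  unfolding subpieces_def by (rule finite_subset[of _ "Pow P"]) auto

lemma Union_subpieces: "\<Union>(subpieces n P D) \<subseteq> P"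
  unfolding subpieces_def by auto

lemma obtain_gap:
  assumes S: "S \<subseteq> {1..n}" "2 \<le> card S" and x: "x \<in> {1..n}" "x \<notin> S"
  obtains u v where "u \<in> S" "v \<in> S" "u \<noteq> v" "x \<in> ccw_between n u v" "S \<inter> ccw_between n u v = {}"
proof -
  have fin: "finite S" using S(1) finite_subset by blast
  define L R where "L = {s \<in> S. s < x}" and "R = {s \<in> S. x < s}"
  have LR: "finite L" "finite R" "S = L \<union> R" using fin x(2) unfolding L_def R_def by (auto simp: not_less_iff_gr_or_eq)
  have ne: "S \<noteq> {}" using S(2) by auto
  \<comment> \<open>The neighbours of \<open>x\<close> in cyclic order: if no label of
    \<open>S\<close> lies below \<open>x\<close>, its predecessor is found by wrapping around to the
    largest label; dually for \<open>v\<close>.\<close>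
  define u where "u = (if L = {} then Max S else Max L)"
  define v where "v = (if R = {} then Min S else Min R)"
  have u: "u \<in> S" unfolding u_def using ne fin LR Max_in[of L] Max_in[of S] by auto
  have v: "v \<in> S" unfolding v_def using ne fin LR Min_in[of R] Min_in[of S] by auto
  have uL: "s \<le> u" if "L = {}" "s \<in> S" for s
    using that fin unfolding u_def by simp
  have uL': "u < x \<and> (\<forall>s\<in>S. s < x \<longrightarrow> s \<le> u)" if "L \<noteq> {}"
    using that LR(1) Max_in[OF LR(1)] unfolding u_def by (auto simp: L_def)
  have vR: "v \<le> s" if "R = {}" "s \<in> S" for s
    using that fin unfolding v_def by simp
  have vR': "x < v \<and> (\<forall>s\<in>S. x < s \<longrightarrow> v \<le> s)" if "R \<noteq> {}"
    using that LR(2) Min_in[OF LR(2)] unfolding v_def by (auto simp: R_def)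
  \<comment> \<open>Two distinct vertices rule out \<open>u = v\<close> in the cases that wrap
    around.\<close>
  obtain s t where st: "s \<in> S" "t \<in> S" "s \<noteq> t"
    using S(2) by (metis card_le_Suc0_iff_eq fin not_less_eq_eq numeral_2_eq_2)
  have L: "s < x" if "R = {}" "s \<in> S" for s using that x(2) unfolding R_def by (metis (mono_tags, lifting) empty_Collect_eq nat_neq_iff)
  have R: "x < s" if "L = {}" "s \<in> S" for s using that x(2) unfolding L_def by (metis (mono_tags, lifting) empty_Collect_eq nat_neq_iff)
  show thesis
  proof (cases "L = {}")
    case True
    note uL = uL[OF True] and R = R[OF True]
    have "R \<noteq> {}" using True LR(3) ne by auto
    note vR' = vR'[OF this]
    have "u \<noteq> v" using uL vR' st R by (metis le_antisym)
    moreover have "v \<le> u" using uL v by blast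
    moreover have "S \<inter> ccw_between n u v = {}"
      using \<open>v \<le> u\<close> uL R vR' by (force simp: mem_ccw_between)
    ultimately show thesis
      using that[OF u v] vR' x(1) by (simp add: mem_ccw_between)
  next
    case False
    note uL' = uL'[OF False]
    show thesis
    proof (cases "R = {}")
      case True
      note vR = vR[OF True] and L = L[OF True]
      have "u \<noteq> v" using uL' vR st L by (metis le_antisym)
      moreover have "v \<le> u" using vR u by blast
      moreover have "S \<inter> ccw_between n u v = {}"
        using \<open>v \<le> u\<close> vR L uL' by (force simp: mem_ccw_between)
      ultimately show thesis
        using that[OF u v] uL' x(1) by (simp add: mem_ccw_between)
    next
      case False
      note vR' = vR'[OF False]
      have "S \<inter> ccw_between n u v = {}"
      proof -
        have "s \<le> u \<or> v \<le> s" if "s \<in> S" for s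
          using that uL' vR' x(2) by (metis nat_neq_iff)
        then show ?thesis using uL' vR' by (force simp: mem_ccw_between)
      qed
      then show thesis
        using that[OF u v] uL' vR' x(1) by (simp add: mem_ccw_between)
    qed
  qed
qed

section \<open>Sides and diagonals of nested polygons\<close>

lemma side_iff:
  assumes "u \<noteq> v"
  shows "{u, v} \<in> polygon_sides n S \<longleftrightarrow>
    u \<in> S \<and> v \<in> S \<and> (S \<inter> ccw_between n u v = {} \<or> S \<inter> ccw_between n v u = {})"
  using assms unfolding polygon_sides_def by (auto simp: doubleton_eq_iff)

lemma diagonal_iff:
  assumes "u \<noteq> v"
  shows "{u, v} \<in> polygon_diagonals n S \<longleftrightarrow>
    u \<in> S \<and> v \<in> S \<and> S \<inter> ccw_between n u v \<noteq> {} \<and> S \<inter> ccw_between n v u \<noteq> {}"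
  using assms unfolding polygon_diagonals_def
  by (simp add: side_iff) (auto simp: doubleton_eq_iff)

lemma sides_diagonals:
  assumes "S \<subseteq> P"
  shows "polygon_sides n S \<subseteq> polygon_sides n P \<union> polygon_diagonals n P"
  using assms unfolding polygon_diagonals_def polygon_sides_def[of n S] by blast

lemma sides_arc:
  assumes S: "S \<subseteq> A" "A \<subseteq> P"
  shows "polygon_sides n S \<inter> polygon_sides n P \<subseteq> polygon_sides n A"
proof
  fix e assume e: "e \<in> polygon_sides n S \<inter> polygon_sides n P"
  then obtain u v where uv: "e = {u, v}" "u \<in> S" "v \<in> S" "u \<noteq> v"
    unfolding polygon_sides_def by auto
  then show "e \<in> polygon_sides n A" using e S by (auto simp: side_iff)
qed

section \<open>Cyclic order relative to a fixed diagonal\<close>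

lemma ccw_between_cases:
  "x \<in> {1..n} \<Longrightarrow> u \<noteq> v \<Longrightarrow> x = u \<or> x = v \<or> x \<in> ccw_between n u v \<or> x \<in> ccw_between n v u"
  by (auto simp: mem_ccw_between)

lemma ccw_between_disjoint:
  "u \<noteq> v \<Longrightarrow> x \<in> ccw_between n u v \<Longrightarrow> x \<noteq> u \<and> x \<noteq> v \<and> x \<notin> ccw_between n v u"
  by (auto simp: mem_ccw_between split: if_splits)

text \<open>With \<open>a\<close> inside the gap from \<open>u\<close> to \<open>v\<close> and
  \<open>b\<close> inside it or at an end, everything outside the gap, apart from \<open>b\<close>
  itself, lies on one side of the diagonal from \<open>a\<close> to \<open>b\<close>.\<close>

lemma no_piece_straddles_gap:
  assumes "a \<noteq> b" "u \<noteq> v" "x \<in> ccw_between n a b" "y \<in> ccw_between n b a" "a \<in> ccw_between n u v"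
    "b = u \<or> b = v \<or> b \<in> ccw_between n u v" "x \<notin> ccw_between n u v" "y \<notin> ccw_between n u v"
  shows False
  using assms by (simp add: mem_ccw_between split: if_splits; linarith)

text \<open>A gap that avoids \<open>a\<close> and \<open>b\<close> but meets the far side stays
  within the far side; its ends lie in the closed near arc, so it is the whole far side.\<close>

lemma arc_gap_unique:
  assumes "a \<noteq> b" "u \<noteq> v" "u = a \<or> u = b \<or> u \<in> ccw_between n a b"
    "v = a \<or> v = b \<or> v \<in> ccw_between n a b" "a \<in> {1..n}" "b \<in> {1..n}"
    "a \<notin> ccw_between n u v" "b \<notin> ccw_between n u v" "k \<in> ccw_between n u v" "k \<in> ccw_between n b a"
  shows "u = b \<and> v = a"
  using assms by (simp add: mem_ccw_between split: if_splits; linarith)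

text \<open>Neither \<open>i\<close> nor \<open>j\<close> lies strictly beyond the diagonal, so a
  way from \<open>i\<close> to \<open>j\<close> that enters the far side traverses all of
  it.\<close>

lemma arc_complement:
  assumes "a \<noteq> b" "i \<noteq> j" "i = a \<or> i = b \<or> i \<in> ccw_between n a b"
    "j = a \<or> j = b \<or> j \<in> ccw_between n a b" "y \<in> ccw_between n b a" "y \<in> ccw_between n i j"
  shows "ccw_between n b a \<subseteq> ccw_between n i j" "ccw_between n j i \<subseteq> ccw_between n a b"
  using assms by (auto simp: mem_ccw_between split: if_splits)

text \<open>The way from \<open>i\<close> to \<open>j\<close> passes \<open>b\<close>. In the arc
  containing \<open>i\<close>, \<open>a\<close> follows \<open>b\<close> directly, so going to
  \<open>a\<close> instead of \<open>b\<close> adds exactly the vertex \<open>b\<close>; dually,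
  starting at \<open>a\<close> adds \<open>b\<close> in the arc containing \<open>j\<close>.\<close>

lemma opposite_split:
  assumes "a \<noteq> b" "i \<in> ccw_between n a b" "j \<in> ccw_between n b a" "b \<in> {1..n}"
  shows "ccw_between n i j = insert b (ccw_between n i b \<union> ccw_between n b j)"
    "ccw_between n i a \<inter> insert b (ccw_between n a b) = insert b (ccw_between n i b)"
    "ccw_between n a j \<inter> insert b (ccw_between n b a) = insert b (ccw_between n b j)"
    "ccw_between n i b \<subseteq> ccw_between n a b" "ccw_between n b j \<subseteq> ccw_between n b a"
  using assms by (auto simp: mem_ccw_between split: if_splits)

lemma card_le_2_if_subset_pair: "S \<subseteq> {u, v} \<Longrightarrow> card S \<le> 2"
  using card_mono[of "{u, v}" S] by (cases "u = v") auto

text \<open>If a piece \<open>S\<close> misses a vertex \<open>x\<close>, the gap around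
  \<open>x\<close> is bounded by a side \<open>{u, v}\<close> of \<open>S\<close>. It cannot be a
  diagonal of \<open>P\<close>, so it is a side of \<open>P\<close>, and with \<open>x\<close> on
  one side of it nothing is left on the other: \<open>S\<close> has at most two vertices.\<close>

lemma subpieces_undissected:
  assumes P: "P \<subseteq> {1..n}" "3 \<le> card P" and D: "polygon_diagonals n P \<inter> D = {}"
  shows "subpieces n P D = {P}"
proof -
  have "S = P" if S: "S \<in> subpieces n P D" for S
  proof (rule ccontr)
    assume "S \<noteq> P"
    then obtain x where x: "x \<in> P" "x \<notin> S" and sub: "S \<subseteq> P"
      using S unfolding subpieces_def by blast
    have S': "S \<subseteq> {1..n}" "3 \<le> card S" "x \<in> {1..n}"
      using S P x unfolding subpieces_def by auto
    have "2 \<le> card S" using S'(2) by simp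
    then obtain u v where uv: "u \<in> S" "v \<in> S" "u \<noteq> v" "x \<in> ccw_between n u v" "S \<inter> ccw_between n u v = {}"
      using obtain_gap[OF S'(1) _ S'(3) x(2)] by metis
    have "{u, v} \<in> polygon_sides n S" using uv by (simp add: side_iff)
    then have "{u, v} \<in> polygon_sides n P"
      using S D sides_diagonals[OF sub] unfolding subpieces_def by blast
    then have "P \<inter> ccw_between n v u = {}"
      using uv x(1) by (auto simp: side_iff)
    then have "S \<subseteq> {u, v}"
      using ccw_between_cases[OF _ uv(3)] uv(5) S'(1) sub by blast
    then have "card S \<le> 2" by (rule card_le_2_if_subset_pair)
    then show False using S'(2) by simp
  qed
  moreover have "P \<in> subpieces n P D"
    using P D unfolding subpieces_def by auto
  ultimately show ?thesis by blast
qed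

section \<open>Geometry of a single cut\<close>

locale dissected_polygon =
  fixes n :: nat and P :: "nat set" and D :: "nat set set" and a b :: nat
  assumes P: "P \<subseteq> {1..n}" and nocross: "\<forall>e\<in>D. \<forall>f\<in>D. \<not> crossing n e f"
    and ab: "a \<noteq> b" "{a, b} \<in> D" "{a, b} \<in> polygon_diagonals n P"
begin

text \<open>Exchanging \<open>a\<close> and \<open>b\<close> transfers every fact about one arc to
  the other.\<close>

lemma swap: "dissected_polygon n P D b a"
  using P nocross ab by (simp add: dissected_polygon_def insert_commute)

lemma ends: "a \<in> P" "b \<in> P" "P \<inter> ccw_between n a b \<noteq> {}" "P \<inter> ccw_between n b a \<noteq> {}"
  using ab by (auto simp: diagonal_iff)

lemma ends_range: "a \<in> {1..n}" "b \<in> {1..n}"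
  using ends P by auto

lemma finite_P: "finite P"
  using P finite_subset by blast

lemma arcs_union: "arc n P a b \<union> arc n P b a = P"
  using ccw_between_cases[OF _ ab(1)] P ends unfolding arc_def by blast

lemma arcs_diff: "arc n P b a - arc n P a b = P \<inter> ccw_between n b a"
  using ccw_between_disjoint[of a b] ccw_between_disjoint[of b a] ab(1)
  unfolding arc_def by blast

lemma arcs_inter: "arc n P a b \<inter> arc n P b a = {a, b}"
  using ccw_between_disjoint[of a b] ab(1) ends unfolding arc_def by blast

lemma finite_arc: "finite (arc n P a b)"
  using finite_P unfolding arc_def by simp

lemma arc_subset: "arc n P a b \<subset> P"
  using arcs_diff ends(4) arcs_union by blast

lemma card_arc: "3 \<le> card (arc n P a b)"
proof -
  obtain x where x: "x \<in> P" "x \<in> ccw_between n a b" using ends(3) by blast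
  have "card {a, b, x} = 3" using ab(1) ccw_between_disjoint[OF ab(1) x(2)] by simp
  moreover have "{a, b, x} \<subseteq> arc n P a b" using x ends unfolding arc_def by auto
  ultimately show ?thesis using card_mono[OF finite_arc] by metis
qed

text \<open>The arcs share only \<open>a\<close> and \<open>b\<close>, so the number of vertices
  beyond the cut equals the total capacity expected of the pieces there; this makes saturation
  possible.\<close>

lemma card_arc_diff: "card (arc n P b a - arc n P a b) = card (arc n P b a) - 2"
proof -
  have "arc n P b a - arc n P a b = arc n P b a - {a, b}" "{a, b} \<subseteq> arc n P b a"
    using arcs_inter by blast+
  then show ?thesis using ab(1) by (simp add: card_Diff_subset)
qed

text \<open>The side \<open>{u, v}\<close> of \<open>S\<close> below the missing vertex
  \<open>a\<close> has vertices of \<open>P\<close> on both sides, so it belongs to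
  \<open>D\<close>. As it does not cross \<open>{a, b}\<close>, \<open>b\<close> lies in the same
  closed gap as \<open>a\<close>, which leaves all of \<open>S\<close> on one side of the
  cut.\<close>

lemma piece_in_arc_if_missing:
  assumes S: "S \<in> subpieces n P D" and a: "a \<notin> S"
    and xy: "x \<in> S" "x \<in> ccw_between n a b" "y \<in> S" "y \<in> ccw_between n b a"
  shows False
proof -
  have sub: "S \<subseteq> P" "S \<subseteq> {1..n}" "3 \<le> card S" using S P unfolding subpieces_def by auto
  have "2 \<le> card S" using sub(3) by simp
  then obtain u v where uv: "u \<in> S" "v \<in> S" "u \<noteq> v" "a \<in> ccw_between n u v" "S \<inter> ccw_between n u v = {}"
    using obtain_gap[OF sub(2) _ ends_range(1) a] by metis
  have "\<not> S \<subseteq> {u, v}"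
    using sub(3) card_le_2_if_subset_pair[of S u v] by auto
  then have "P \<inter> ccw_between n v u \<noteq> {}"
    using ccw_between_cases[OF _ uv(3)] uv(5) sub by blast
  then have "{u, v} \<notin> polygon_sides n P"
    using uv(3,4) ends(1) by (auto simp: side_iff)
  moreover have "{u, v} \<in> polygon_sides n S" using uv by (simp add: side_iff)
  ultimately have "{u, v} \<in> D"
    using S unfolding subpieces_def by blast
  then have "b \<notin> ccw_between n v u"
    using nocross ab(2) uv(4) unfolding crossing_def by blast
  then have "b = u \<or> b = v \<or> b \<in> ccw_between n u v"
    using ccw_between_cases[OF ends_range(2) uv(3)] by blast
  then show False
    using no_piece_straddles_gap[OF ab(1) uv(3) xy(2,4) uv(4)] xy uv(5) by blast
qed

lemma piece_in_arc:
  assumes S: "S \<in> subpieces n P D"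
  shows "S \<subseteq> arc n P a b \<or> S \<subseteq> arc n P b a"
proof (rule ccontr)
  assume "\<not> ?thesis"
  then obtain x y where xy: "x \<in> S" "x \<notin> arc n P b a" "y \<in> S" "y \<notin> arc n P a b" by blast
  have sub: "S \<subseteq> P" using S unfolding subpieces_def by auto
  have x: "x \<in> ccw_between n a b" and y: "y \<in> ccw_between n b a"
    using xy sub P ccw_between_cases[OF _ ab(1)] unfolding arc_def by blast+
  have "a \<in> S" using piece_in_arc_if_missing[OF S _ xy(1) x xy(3) y] by blast
  moreover have "b \<in> S"
    using dissected_polygon.piece_in_arc_if_missing[OF swap S _ xy(3) y xy(1) x] by blast
  \<comment> \<open>Containing both ends of the cut and vertices on either side of it,
    \<open>S\<close> would be cut further by \<open>D\<close>.\<close>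
  ultimately have "{a, b} \<in> polygon_diagonals n S"
    using x y xy ab(1) by (auto simp: diagonal_iff)
  then show False using S ab(2) unfolding subpieces_def by blast
qed

text \<open>Each side of the arc is a side of \<open>P\<close> or the cut itself, which lies in
  \<open>D\<close>; conversely, sides of \<open>P\<close> inside the arc are sides of the arc. Hence
  the condition on the sides of a piece is the same for both polygons.\<close>

lemma subpieces_arc: "subpieces n (arc n P a b) D = {S \<in> subpieces n P D. S \<subseteq> arc n P a b}"
proof -
  let ?A = "arc n P a b"
  have A: "?A \<subseteq> P" using arc_subset by blast
  have "polygon_sides n ?A \<subseteq> polygon_sides n P \<union> D"
  proof
    fix e assume "e \<in> polygon_sides n ?A"
    then obtain u v where uv: "e = {u, v}" "u \<in> ?A" "v \<in> ?A" "u \<noteq> v" "?A \<inter> ccw_between n u v = {}"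
      unfolding polygon_sides_def by auto
    show "e \<in> polygon_sides n P \<union> D"
    proof (cases "P \<inter> ccw_between n u v = {}")
      case True
      then show ?thesis using uv A by (auto simp: side_iff)
    next
      case False
      \<comment> \<open>A gap that is empty in the arc but not in \<open>P\<close> must be the one
        across the cut.\<close>
      then obtain k where k: "k \<in> P" "k \<in> ccw_between n u v" by blast
      then have "k \<in> arc n P b a - ?A"
        using uv(5) arcs_union by blast
      then have "k \<in> ccw_between n b a" by (simp add: arcs_diff)
      moreover have "a \<notin> ccw_between n u v" "b \<notin> ccw_between n u v"
        using uv(5) ends unfolding arc_def by blast+
      ultimately have "u = b \<and> v = a"
        using uv(2,3) k(2) unfolding arc_def
        by (intro arc_gap_unique[OF ab(1) uv(4) _ _ ends_range]) auto
      then show ?thesis using uv(1) ab(2) by (simp add: insert_commute)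
    qed
  qed
  then have "polygon_sides n S \<subseteq> polygon_sides n ?A \<union> D \<longleftrightarrow> polygon_sides n S \<subseteq> polygon_sides n P \<union> D"
    if "S \<subseteq> ?A" for S
    using sides_arc[OF that A, of n] by blast
  then show ?thesis
    using A unfolding subpieces_def by auto
qed

lemma subpieces_cut:
  "subpieces n P D = subpieces n (arc n P a b) D \<union> subpieces n (arc n P b a) D"
  unfolding subpieces_arc dissected_polygon.subpieces_arc[OF swap]
  by (auto dest: piece_in_arc)

lemma subpieces_arcs_disjoint:
  "subpieces n (arc n P a b) D \<inter> subpieces n (arc n P b a) D = {}"
proof -
  have False if "S \<in> subpieces n (arc n P a b) D" "S \<in> subpieces n (arc n P b a) D" for S
  proof -
    have "S \<subseteq> arc n P a b \<inter> arc n P b a" "3 \<le> card S"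
      using that unfolding subpieces_def by auto
    then show False
      unfolding arcs_inter using card_le_2_if_subset_pair[of S a b] by simp
  qed
  then show ?thesis by blast
qed

section \<open>Capacities and path counts across the cut\<close>

lemma capacity_cut:
  assumes "(\<Sum>S\<in>subpieces n (arc n P a b) D. card S - 2) = card (arc n P a b) - 2"
    and "(\<Sum>S\<in>subpieces n (arc n P b a) D. card S - 2) = card (arc n P b a) - 2"
  shows "(\<Sum>S\<in>subpieces n P D. card S - 2) = card P - 2"
proof -
  interpret s: dissected_polygon n P D b a by (rule swap)
  have "card P = card (arc n P a b) + card (arc n P b a - arc n P a b)"
    using arcs_union card_Un_disjoint[of "arc n P a b" "arc n P b a - arc n P a b"]
      finite_arc s.finite_arc by simp
  then have "card P - 2 = (card (arc n P a b) - 2) + (card (arc n P b a) - 2)"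
    using card_arc_diff card_arc s.card_arc by simp
  then show ?thesis
    unfolding subpieces_cut using assms subpieces_arcs_disjoint finite_arc s.finite_arc
    by (simp add: sum.union_disjoint finite_subpieces)
qed

text \<open>The vertex \<open>y\<close> records which of the two ways passes beyond the cut. That
  way saturates the far pieces in the single manner given by \<open>one\<close>; the other way never
  uses them.\<close>

lemma count_same_side:
  assumes cap: "(\<Sum>S\<in>subpieces n (arc n P b a) D. card S - 2) = card (arc n P b a) - 2"
    and one: "card (assignments (P \<inter> ccw_between n b a) (subpieces n (arc n P b a) D)) = 1"
    and ij: "i \<in> arc n P a b" "j \<in> arc n P a b" "i \<noteq> j"
    and y: "y \<in> P" "y \<in> ccw_between n b a" "y \<in> ccw_between n i j"
  shows "card (assignments (P \<inter> ccw_between n i j) (subpieces n P D)) =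
      card (assignments (arc n P a b \<inter> ccw_between n i j) (subpieces n (arc n P a b) D))"
    and "card (assignments (P \<inter> ccw_between n j i) (subpieces n P D)) =
      card (assignments (arc n P a b \<inter> ccw_between n j i) (subpieces n (arc n P a b) D))"
proof -
  interpret s: dissected_polygon n P D b a by (rule swap)
  have sub: "ccw_between n b a \<subseteq> ccw_between n i j" "ccw_between n j i \<subseteq> ccw_between n a b"
    using arc_complement[OF ab(1) ij(3) _ _ y(2,3)] ij(1,2) unfolding arc_def by blast+
  have "card (assignments (P \<inter> ccw_between n i j) (subpieces n P D)) =
      card (assignments (P \<inter> ccw_between n i j \<inter> arc n P a b) (subpieces n (arc n P a b) D))"
    unfolding subpieces_cut
  proof (rule card_assignments_union_saturated[OF Union_subpieces Union_subpieces finite_arc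
        s.finite_arc subpieces_arcs_disjoint])
    show "P \<inter> ccw_between n i j \<subseteq> arc n P a b \<union> arc n P b a"
      unfolding arcs_union by blast
    show "arc n P b a - arc n P a b \<subseteq> P \<inter> ccw_between n i j"
      unfolding arcs_diff using sub(1) by blast
    show "(\<Sum>S\<in>subpieces n (arc n P b a) D. card S - 2) = card (arc n P b a - arc n P a b)"
      using cap card_arc_diff by simp
    show "card (assignments (arc n P b a - arc n P a b) (subpieces n (arc n P b a) D)) = 1"
      unfolding arcs_diff by (rule one)
  qed
  moreover have "P \<inter> ccw_between n i j \<inter> arc n P a b = arc n P a b \<inter> ccw_between n i j"
    using arc_subset by blast
  ultimately show "card (assignments (P \<inter> ccw_between n i j) (subpieces n P D)) =
      card (assignments (arc n P a b \<inter> ccw_between n i j) (subpieces n (arc n P a b) D))" by simp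
  have "card (assignments (P \<inter> ccw_between n j i) (subpieces n P D)) =
      card (assignments (P \<inter> ccw_between n j i) (subpieces n (arc n P a b) D))"
    unfolding subpieces_cut
  proof (rule card_assignments_union_one_side[OF Union_subpieces Union_subpieces finite_arc
        s.finite_arc subpieces_arcs_disjoint])
    show "P \<inter> ccw_between n j i \<subseteq> arc n P a b - arc n P b a"
      unfolding s.arcs_diff using sub(2) by blast
  qed
  moreover have "P \<inter> ccw_between n j i = arc n P a b \<inter> ccw_between n j i"
    using sub(2) unfolding arc_def by blast
  ultimately show "card (assignments (P \<inter> ccw_between n j i) (subpieces n P D)) =
      card (assignments (arc n P a b \<inter> ccw_between n j i) (subpieces n (arc n P a b) D))" by simp
qed

text \<open>In the first product the vertex \<open>b\<close> gets a piece on the side of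
  \<open>j\<close>, in the second a piece on the side of \<open>i\<close>.\<close>

lemma count_opposite_sides:
  assumes i: "i \<in> P" "i \<in> ccw_between n a b" and j: "j \<in> P" "j \<in> ccw_between n b a"
  defines "N x y c d \<equiv> card (assignments (arc n P c d \<inter> ccw_between n x y) (subpieces n (arc n P c d) D))"
  shows "card (assignments (P \<inter> ccw_between n i j) (subpieces n P D)) =
    N i b a b * N a j b a + N i a a b * N b j b a"
proof -
  interpret s: dissected_polygon n P D b a by (rule swap)
  note os = opposite_split[OF ab(1) i(2) j(2) ends_range(2)]
  have dis: "a \<notin> ccw_between n a b" "a \<notin> ccw_between n b a"
    using ccw_between_disjoint[of a b] ccw_between_disjoint[of b a] ab(1) by blast+
  let ?X1 = "arc n P a b \<inter> ccw_between n i b" and ?X2 = "arc n P b a \<inter> ccw_between n b j"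
  have "P \<inter> ccw_between n i j = insert b (?X1 \<union> ?X2)"
    using os(1,4,5) ends unfolding arc_def by blast
  moreover have "arc n P b a \<inter> ccw_between n a j = insert b ?X2"
  proof -
    have "a \<notin> ccw_between n a j" using j(2) dis(2) ccw_between_disjoint[of a j a] by blast
    then have "arc n P b a \<inter> ccw_between n a j = P \<inter> (ccw_between n a j \<inter> insert b (ccw_between n b a))"
      unfolding arc_def by blast
    also have "\<dots> = insert b ?X2"
      unfolding os(3) using os(5) ends(2) unfolding arc_def by blast
    finally show ?thesis .
  qed
  moreover have "arc n P a b \<inter> ccw_between n i a = insert b ?X1"
  proof -
    have "a \<notin> ccw_between n i a" using i(2) dis(1) ccw_between_disjoint[of i a a] by blast
    then have "arc n P a b \<inter> ccw_between n i a = P \<inter> (ccw_between n i a \<inter> insert b (ccw_between n a b))"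
      unfolding arc_def by blast
    also have "\<dots> = insert b ?X1"
      unfolding os(2) using os(4) ends(2) unfolding arc_def by blast
    finally show ?thesis .
  qed
  moreover have "card (assignments (insert b (?X1 \<union> ?X2)) (subpieces n P D)) =
     card (assignments ?X1 (subpieces n (arc n P a b) D)) *
       card (assignments (insert b ?X2) (subpieces n (arc n P b a) D)) +
     card (assignments (insert b ?X1) (subpieces n (arc n P a b) D)) *
       card (assignments ?X2 (subpieces n (arc n P b a) D))"
    unfolding subpieces_cut
  proof (rule card_assignments_union_straddle[OF Union_subpieces Union_subpieces finite_arc
        s.finite_arc subpieces_arcs_disjoint])
    show "?X1 \<subseteq> arc n P a b - arc n P b a" "?X2 \<subseteq> arc n P b a - arc n P a b"
      unfolding arcs_diff s.arcs_diff using os(4,5) arc_subset s.arc_subset by blast+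
    show "b \<in> arc n P a b" "b \<in> arc n P b a"
      using ends(2) unfolding arc_def by simp_all
  qed
  ultimately show ?thesis unfolding N_def by simp
qed

end


text \<open>The two claims are proved together: capacities of the smaller polygons give saturation,
  and their symmetry shows that the saturating assignment is unique.\<close>

lemma subpieces_capacity_and_symmetry:
  assumes "P \<subseteq> {1..n}" "3 \<le> card P" "\<forall>e\<in>D. \<forall>f\<in>D. \<not> crossing n e f"
  shows "(\<Sum>S\<in>subpieces n P D. card S - 2) = card P - 2 \<and>
    (\<forall>i\<in>P. \<forall>j\<in>P. card (assignments (P \<inter> ccw_between n i j) (subpieces n P D)) =
      card (assignments (P \<inter> ccw_between n j i) (subpieces n P D)))"
  using assms
proof (induction "card P" arbitrary: P rule: less_induct)
  case less
  have fin: "finite P" using less.prems(1) finite_subset by blast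
  show ?case
  proof (cases "polygon_diagonals n P \<inter> D = {}")
    case True
    then have eq: "subpieces n P D = {P}" using less.prems by (intro subpieces_undissected)
    \<comment> \<open>With \<open>i\<close> and \<open>j\<close> both left out, the vertices fit
      into the single piece. A full turn would not fit, but for \<open>i = j\<close> symmetry is
      trivial.\<close>
    have "card (assignments (P \<inter> ccw_between n i j) {P}) = 1" if ij: "i \<in> P" "j \<in> P" "i \<noteq> j" for i j
    proof (rule card_assignments_singleton)
      have "P \<inter> ccw_between n i j \<subseteq> P - {i, j}"
        using ccw_between_disjoint[OF ij(3)] by blast
      then have "card (P \<inter> ccw_between n i j) \<le> card (P - {i, j})"
        using fin by (intro card_mono) auto
      then show "card (P \<inter> ccw_between n i j) \<le> card P - 2"
        using ij by (simp add: card_Diff_subset)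
    qed simp
    then have "card (assignments (P \<inter> ccw_between n i j) {P}) =
        card (assignments (P \<inter> ccw_between n j i) {P})" if "i \<in> P" "j \<in> P" for i j
      using that by (cases "i = j") auto
    then show ?thesis unfolding eq by simp
  next
    case False
    then obtain a b where ab: "a \<noteq> b" "{a, b} \<in> D" "{a, b} \<in> polygon_diagonals n P"
      unfolding polygon_diagonals_def by blast
    interpret dissected_polygon n P D a b
      using less.prems ab by unfold_locales
    interpret s: dissected_polygon n P D b a by (rule swap)
    define N where "N x y c d =
      card (assignments (arc n P c d \<inter> ccw_between n x y) (subpieces n (arc n P c d) D))" for x y c d
    define M where "M x y = card (assignments (P \<inter> ccw_between n x y) (subpieces n P D))" for x y
    have IH: "(\<Sum>S\<in>subpieces n (arc n P c d) D. card S - 2) = card (arc n P c d) - 2"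
        "\<And>x y. x \<in> arc n P c d \<Longrightarrow> y \<in> arc n P c d \<Longrightarrow> N x y c d = N y x c d"
      if "dissected_polygon n P D c d" for c d
    proof -
      interpret cd: dissected_polygon n P D c d by (rule that)
      have *: "card (arc n P c d) < card P" "arc n P c d \<subseteq> {1..n}"
        using psubset_card_mono[OF fin cd.arc_subset] cd.arc_subset less.prems(1) by auto
      show "(\<Sum>S\<in>subpieces n (arc n P c d) D. card S - 2) = card (arc n P c d) - 2"
        "\<And>x y. x \<in> arc n P c d \<Longrightarrow> y \<in> arc n P c d \<Longrightarrow> N x y c d = N y x c d"
        using less.hyps[OF * cd.card_arc less.prems(3)] unfolding N_def by blast+
    qed
    have same: "M i j = M j i"
      if cd: "dissected_polygon n P D c d" and ij: "i \<in> arc n P c d" "j \<in> arc n P c d" "i \<noteq> j" for c d i j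
    proof -
      interpret cd: dissected_polygon n P D c d by (rule cd)
      interpret dc: dissected_polygon n P D d c by (rule cd.swap)
      have cd_arc: "c \<in> arc n P d c" "d \<in> arc n P d c"
        using cd.ends unfolding arc_def by auto
      \<comment> \<open>Uniqueness of the saturating assignment is an instance of symmetry: in the
        far arc, the way from \<open>d\<close> to \<open>c\<close> meets all other vertices and the
        way back meets none, so both counts are 1.\<close>
      have "arc n P d c \<inter> ccw_between n d c = P \<inter> ccw_between n d c"
        unfolding arc_def by blast
      moreover have "arc n P d c \<inter> ccw_between n c d = {}"
        using ccw_between_disjoint[OF cd.ab(1)] unfolding arc_def by blast
      ultimately have one: "card (assignments (P \<inter> ccw_between n d c) (subpieces n (arc n P d c) D)) = 1"
        using IH(2)[OF cd.swap cd_arc] by (simp add: N_def card_assignments_empty)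
      obtain y where y: "y \<in> P" "y \<in> ccw_between n d c" using cd.ends(4) by blast
      have "y \<noteq> i" "y \<noteq> j"
        using y(2) ij ccw_between_disjoint[OF cd.ab(1)] ccw_between_disjoint[OF dc.ab(1) y(2)]
        unfolding arc_def by blast+
      then consider "y \<in> ccw_between n i j" | "y \<in> ccw_between n j i"
        using ccw_between_cases[OF _ ij(3)] y(1) less.prems(1) by blast
      then show ?thesis
      proof cases
        case 1
        show ?thesis
          using cd.count_same_side[OF IH(1)[OF cd.swap] one ij y 1] IH(2)[OF cd ij(1,2)]
          unfolding M_def N_def by simp
      next
        case 2
        show ?thesis
          using cd.count_same_side[OF IH(1)[OF cd.swap] one ij(2,1) ij(3)[symmetric] y 2] IH(2)[OF cd ij(1,2)]
          unfolding M_def N_def by simp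
      qed
    qed
    have opposite: "M i j = M j i"
      if i: "i \<in> P" "i \<in> ccw_between n a b" and j: "j \<in> P" "j \<in> ccw_between n b a" for i j
    proof -
      have arcs: "i \<in> arc n P a b" "j \<in> arc n P b a" "a \<in> arc n P a b" "b \<in> arc n P a b"
          "a \<in> arc n P b a" "b \<in> arc n P b a"
        using i j ends unfolding arc_def by auto
      have "M i j = N i b a b * N a j b a + N i a a b * N b j b a"
        using count_opposite_sides[OF i j] unfolding M_def N_def .
      \<comment> \<open>The way back passes \<open>a\<close>, so the formula applies with
        \<open>a\<close> and \<open>b\<close> exchanged; the induction hypothesis then matches the
        two sums term by term.\<close>
      moreover have "M j i = N j a b a * N b i a b + N j b b a * N a i a b"
        using s.count_opposite_sides[OF j i] unfolding M_def N_def .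
      ultimately show ?thesis
        using IH(2)[OF dissected_polygon_axioms arcs(1,3)] IH(2)[OF dissected_polygon_axioms arcs(1,4)]
          IH(2)[OF swap arcs(2,5)] IH(2)[OF swap arcs(2,6)] by simp
    qed
    have "M i j = M j i" if ij: "i \<in> P" "j \<in> P" for i j
    proof -
      consider "i = j" | "i \<noteq> j" "i \<in> arc n P a b" "j \<in> arc n P a b"
        | "i \<noteq> j" "i \<in> arc n P b a" "j \<in> arc n P b a"
        | "i \<in> ccw_between n a b" "j \<in> ccw_between n b a"
        | "j \<in> ccw_between n a b" "i \<in> ccw_between n b a"
        using ij ccw_between_cases[OF _ ab(1)] less.prems(1) unfolding arc_def by blast
      then show ?thesis
      proof cases
        case 2
        then show ?thesis using same[OF dissected_polygon_axioms] by blast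
      next
        case 3
        then show ?thesis using same[OF swap] by blast
      next
        case 4
        then show ?thesis using opposite ij by blast
      next
        case 5
        then show ?thesis using opposite[of j i] ij by simp
      qed simp
    qed
    then show ?thesis
      using capacity_cut[OF IH(1)[OF dissected_polygon_axioms] IH(1)[OF swap]] unfolding M_def by blast
  qed
qed

theorem theorem2p4:
  fixes n d m :: nat and T :: "nat set set"
  assumes "d \<ge> 3"
    and "n = d + m * (d - 2)"
    and "d_angulation d n T"
  shows "\<forall>i\<in>{1..n}. \<forall>j\<in>{1..n}. path_matrix d n T i j = path_matrix d n T j i"
proof -
  have T: "\<forall>e\<in>T. \<forall>f\<in>T. \<not> crossing n e f" "\<forall>S\<in>pieces n T. card S = d"
    using assms(3) unfolding d_angulation_def dissection_def by auto
  have "3 \<le> card {1..n}" using assms(1,2) by simp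
  note sym = subpieces_capacity_and_symmetry[OF subset_refl this T(1)]
  have "subpieces n {1..n} T = pieces n T"
    unfolding subpieces_def pieces_def by simp
  moreover have "{1..n} \<inter> ccw_between n i j = ccw_between n i j" for i j
    unfolding ccw_between_def by blast
  \<comment> \<open>All pieces have \<open>d\<close> vertices, so the bound \<open>d - 2\<close> is
    the capacity of each piece.\<close>
  moreover have "d_paths d n T i j = assignments (ccw_between n i j) (pieces n T)" for i j
    using T(2) unfolding d_paths_def assignments_def by auto
  ultimately show ?thesis
    using sym unfolding path_matrix_def by simp
qed

end
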